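(* Let $\alpha>0$ and let $\mu$ be a positive Borel measure on $(0,\infty)$ such that $\mu((0,1))=0$ and $\sup_{n\in\mathbb{N}}\int_{1}^{\infty}t^{-(n+1)}\,d\mu(t)<\infty$. Then for $p\in(0,\infty)$, the Hausdorff operator $\mathcal{H}_{\mu}$ belongs to the Schatten class $\mathcal{S}_{p}(F^2_{\alpha})$ if and only if $$\sum_{n=0}^{\infty}\left(\int_{1}^{\infty}\frac{1}{t^{n+1}}\,d\mu(t)\right)^{p}<\infty.$$
   Context: $\mathbb{N}=\{0,1,2,\dots\}$. The Fock space $F^2_\alpha$ is the Hilbert space of entire functions $f$ with $\|f\|^2=\frac{\alpha}{\pi}\int_{\mathbb{C}}|f(z)|^2e^{-\alpha|z|^2}\,dA(z)<\infty$, where $dA$ is Lebesgue area measure. For a positive Borel measure $\mu$ on $(0,\infty)$, the Hausdorff operator is $\mathcal{H}_{\mu}(f)(z)=\int_{0}^{\infty}\frac{1}{t}f\left(\frac{z}{t}\right)d\mu(t)$, $z\in\mathbb{C}$. For $0<p<\infty$, $\mathcal{S}_p(F^2_\alpha)$ is the class of compact operators on $F^2_\alpha$ whose sequence of singular values lies in $\ell^p$. *)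

theory Defs
  imports "HOL-Analysis.Analysis"
begin

definition fock_sq_norm :: "real \<Rightarrow> (complex \<Rightarrow> complex) \<Rightarrow> ennreal" where
  "fock_sq_norm \<alpha> f =
     ennreal (\<alpha> / pi) * (\<integral>\<^sup>+ z. ennreal ((cmod (f z))\<^sup>2 * exp (- \<alpha> * (cmod z)\<^sup>2)) \<partial>lborel)"

definition fock_space :: "real \<Rightarrow> (complex \<Rightarrow> complex) set" where
  "fock_space \<alpha> = {f. f holomorphic_on UNIV \<and> fock_sq_norm \<alpha> f < \<infinity>}"

definition fock_norm :: "real \<Rightarrow> (complex \<Rightarrow> complex) \<Rightarrow> real" where
  "fock_norm \<alpha> f = sqrt (enn2real (fock_sq_norm \<alpha> f))"

definition hausdorff_op :: "real measure \<Rightarrow> (complex \<Rightarrow> complex) \<Rightarrow> (complex \<Rightarrow> complex)" where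
  "hausdorff_op \<mu> f = (\<lambda>z. \<integral>t. (1 / complex_of_real t) * f (z / complex_of_real t) \<partial>\<mu>)"

definition fock_linear_op :: "real \<Rightarrow> ((complex \<Rightarrow> complex) \<Rightarrow> (complex \<Rightarrow> complex)) \<Rightarrow> bool" where
  "fock_linear_op \<alpha> T \<longleftrightarrow>
     (\<forall>f\<in>fock_space \<alpha>. T f \<in> fock_space \<alpha>) \<and>
     (\<forall>f\<in>fock_space \<alpha>. \<forall>g\<in>fock_space \<alpha>. T (\<lambda>z. f z + g z) = (\<lambda>z. T f z + T g z)) \<and>
     (\<forall>f\<in>fock_space \<alpha>. \<forall>c. T (\<lambda>z. c * f z) = (\<lambda>z. c * T f z))"

text \<open>Operator norm on F^2_alpha (in ennreal, so unbounded operators get infinity).\<close>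

definition fock_op_norm :: "real \<Rightarrow> ((complex \<Rightarrow> complex) \<Rightarrow> (complex \<Rightarrow> complex)) \<Rightarrow> ennreal" where
  "fock_op_norm \<alpha> T = (SUP f\<in>{f\<in>fock_space \<alpha>. fock_norm \<alpha> f \<le> 1}. ennreal (fock_norm \<alpha> (T f)))"

definition fock_rank_le :: "real \<Rightarrow> nat \<Rightarrow> ((complex \<Rightarrow> complex) \<Rightarrow> (complex \<Rightarrow> complex)) \<Rightarrow> bool" where
  "fock_rank_le \<alpha> n R \<longleftrightarrow> fock_linear_op \<alpha> R \<and>
     (\<exists>g :: nat \<Rightarrow> complex \<Rightarrow> complex. (\<forall>i<n. g i \<in> fock_space \<alpha>) \<and>
        (\<forall>f\<in>fock_space \<alpha>. \<exists>a :: nat \<Rightarrow> complex. R f = (\<lambda>z. \<Sum>i<n. a i * g i z)))"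

text \<open>n-th singular value (n = 0,1,2,...), as the n-th approximation number:
  s_n(T) = inf { ||T - R|| : rank R <= n }.  For compact operators on a Hilbert space this
  coincides with the n-th eigenvalue of |T| = sqrt(T*T) (counted with multiplicity, decreasing).\<close>

definition fock_sing_val :: "real \<Rightarrow> ((complex \<Rightarrow> complex) \<Rightarrow> (complex \<Rightarrow> complex)) \<Rightarrow> nat \<Rightarrow> ennreal" where
  "fock_sing_val \<alpha> T n =
     (INF R\<in>{R. fock_rank_le \<alpha> n R}. fock_op_norm \<alpha> (\<lambda>f z. T f z - R f z))"

text \<open>Compactness on F^2_alpha: the image of the closed unit ball is totally bounded
  (equivalently relatively compact, F^2_alpha being complete).\<close>

definition fock_compact_op :: "real \<Rightarrow> ((complex \<Rightarrow> complex) \<Rightarrow> (complex \<Rightarrow> complex)) \<Rightarrow> bool" where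
  "fock_compact_op \<alpha> T \<longleftrightarrow> fock_linear_op \<alpha> T \<and>
     (\<forall>e>0. \<exists>G. finite G \<and> G \<subseteq> fock_space \<alpha> \<and>
        (\<forall>f\<in>fock_space \<alpha>. fock_norm \<alpha> f \<le> 1 \<longrightarrow>
            (\<exists>g\<in>G. fock_norm \<alpha> (\<lambda>z. T f z - g z) < e)))"

definition schatten_class :: "real \<Rightarrow> real \<Rightarrow> ((complex \<Rightarrow> complex) \<Rightarrow> (complex \<Rightarrow> complex)) \<Rightarrow> bool" where
  "schatten_class \<alpha> p T \<longleftrightarrow> fock_compact_op \<alpha> T \<and>
     (\<forall>n. fock_sing_val \<alpha> T n < \<infinity>) \<and>
     summable (\<lambda>n. (enn2real (fock_sing_val \<alpha> T n)) powr p)"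

end

theory Submission
  imports Defs "HOL-Complex_Analysis.Cauchy_Integral_Formula" "HOL-Probability.Distributions"
begin

text \<open>
  Averaging over rotations, which preserve planar Lebesgue measure, shows that the squared Fock
  norm of an entire function \<open>\<Sum> a\<^sub>k z\<^sup>k\<close> is \<open>\<Sum> |a\<^sub>k|\<^sup>2 w\<^sub>k\<close>, where \<open>w\<^sub>k\<close> is the squared norm of
  \<open>z\<^sup>k\<close>. Integrating the Taylor series term by term, the Hausdorff operator multiplies \<open>a\<^sub>k\<close> by
  the moment \<open>m\<^sub>k = \<integral> t\<^bsup>-(k+1)\<^esup> d\<mu>\<close>. It is thus diagonal in an orthogonal basis, and since
  \<open>m\<^sub>k\<close> is decreasing, its \<open>n\<close>-th singular value is exactly \<open>m\<^sub>n\<close>; of the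
  weights only finiteness and positivity matter, not the explicit form \<open>k! / \<alpha>\<^sup>k\<close>.
\<close>

subsection \<open>Rotation invariance of planar Lebesgue measure\<close>

text \<open>Lebesgue measure is characterised by its values on boxes, and a complex box pulls back
  to a product box with the same side lengths. This opens the way to Tonelli in real and imaginary
  parts.\<close>

lemma lborel_complex_eq_distr:
  "(lborel :: complex measure) = distr (lborel :: (real \<times> real) measure) borel (\<lambda>(x, y). Complex x y)"
proof (rule lborel_eqI)
  have [measurable]: "(\<lambda>(x, y). Complex x y) \<in> borel_measurable (borel :: (real \<times> real) measure)"
    by (intro borel_measurable_continuous_onI) (auto simp: case_prod_beta Complex_eq intro!: continuous_intros)
  fix l u :: complex
  assume le: "\<And>b. b \<in> Basis \<Longrightarrow> l \<bullet> b \<le> u \<bullet> b"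
  have *: "(\<lambda>(x, y). Complex x y) -` box l u = box (Re l, Im l) (Re u, Im u)"
    by (auto simp: box_def Basis_complex_def Basis_prod_def inner_complex_def)
  have "emeasure (distr (lborel :: (real \<times> real) measure) borel (\<lambda>(x, y). Complex x y)) (box l u)
        = emeasure lborel (box (Re l, Im l) (Re u, Im u))"
    by (subst emeasure_distr) (auto simp: *)
  also have "\<dots> = (\<Prod>b\<in>Basis. ((Re u, Im u) - (Re l, Im l)) \<bullet> b)"
    using le[of 1] le[of \<i>] by (intro emeasure_lborel_box)
       (auto simp: Basis_complex_def Basis_prod_def inner_complex_def)
  also have "(\<Prod>b\<in>Basis. ((Re u, Im u) - (Re l, Im l)) \<bullet> b) = (\<Prod>b\<in>Basis. (u - l) \<bullet> b)"
    by (simp add: Basis_complex_def Basis_prod_def inner_complex_def)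
  finally show "emeasure (distr (lborel :: (real \<times> real) measure) borel (\<lambda>(x, y). Complex x y)) (box l u)
     = (\<Prod>b\<in>Basis. (u - l) \<bullet> b)" .
qed simp

text \<open>Both orders of integration are kept, so that whichever coordinate is sheared can be the
  inner variable.\<close>

lemma nn_integral_lborel_complex:
  fixes f :: "complex \<Rightarrow> ennreal"
  assumes [measurable]: "f \<in> borel_measurable borel"
  shows "(\<integral>\<^sup>+ z. f z \<partial>lborel) = (\<integral>\<^sup>+ y. \<integral>\<^sup>+ x. f (Complex x y) \<partial>lborel \<partial>lborel)"
    and "(\<integral>\<^sup>+ z. f z \<partial>lborel) = (\<integral>\<^sup>+ x. \<integral>\<^sup>+ y. f (Complex x y) \<partial>lborel \<partial>lborel)"
proof -
  have [measurable]: "(\<lambda>(x, y). Complex x y) \<in> borel_measurable (borel :: (real \<times> real) measure)"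
    by (intro borel_measurable_continuous_onI) (auto simp: case_prod_beta Complex_eq intro!: continuous_intros)
  have m: "(\<lambda>p. f (case p of (x, y) \<Rightarrow> Complex x y)) \<in> borel_measurable (lborel \<Otimes>\<^sub>M lborel)"
    unfolding lborel_prod by measurable
  have "(\<integral>\<^sup>+ z. f z \<partial>lborel) = (\<integral>\<^sup>+ p. f (case p of (x, y) \<Rightarrow> Complex x y) \<partial>(lborel \<Otimes>\<^sub>M lborel))"
    by (subst lborel_complex_eq_distr) (simp add: nn_integral_distr lborel_prod)
  then show "(\<integral>\<^sup>+ z. f z \<partial>lborel) = (\<integral>\<^sup>+ y. \<integral>\<^sup>+ x. f (Complex x y) \<partial>lborel \<partial>lborel)"
    and "(\<integral>\<^sup>+ z. f z \<partial>lborel) = (\<integral>\<^sup>+ x. \<integral>\<^sup>+ y. f (Complex x y) \<partial>lborel \<partial>lborel)"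
    using lborel_pair.nn_integral_snd[OF m] lborel.nn_integral_fst[OF m] by simp_all
qed

lemma nn_integral_lborel_translation:
  fixes f :: "real \<Rightarrow> ennreal"
  assumes "f \<in> borel_measurable borel"
  shows "(\<integral>\<^sup>+ x. f (x + c) \<partial>lborel) = (\<integral>\<^sup>+ x. f x \<partial>lborel)"
  using nn_integral_real_affine[OF assms, of 1 c] by (simp add: add.commute)

text \<open>For a fixed value of the other coordinate, a shear merely translates the moving
  one.\<close>

lemma nn_integral_complex_shear:
  fixes f :: "complex \<Rightarrow> ennreal"
  assumes f[measurable]: "f \<in> borel_measurable borel"
  shows "(\<integral>\<^sup>+ z. f (Complex (Re z + c * Im z) (Im z)) \<partial>lborel) = (\<integral>\<^sup>+ z. f z \<partial>lborel)"
    and "(\<integral>\<^sup>+ z. f (Complex (Re z) (Im z + c * Re z)) \<partial>lborel) = (\<integral>\<^sup>+ z. f z \<partial>lborel)"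
proof -
  have [measurable]: "(\<lambda>z. Complex (Re z + c * Im z) (Im z)) \<in> borel_measurable borel"
     "(\<lambda>z. Complex (Re z) (Im z + c * Re z)) \<in> borel_measurable borel"
     "(\<lambda>x. Complex x y) \<in> borel_measurable borel" "(\<lambda>x. Complex y x) \<in> borel_measurable borel" for y
    by (auto intro!: borel_measurable_continuous_onI continuous_intros simp: Complex_eq)
  show "(\<integral>\<^sup>+ z. f (Complex (Re z + c * Im z) (Im z)) \<partial>lborel) = (\<integral>\<^sup>+ z. f z \<partial>lborel)"
    by (subst (1 2) nn_integral_lborel_complex(1))
       (auto intro!: nn_integral_cong nn_integral_lborel_translation[of "\<lambda>x. f (Complex x _)"])
  show "(\<integral>\<^sup>+ z. f (Complex (Re z) (Im z + c * Re z)) \<partial>lborel) = (\<integral>\<^sup>+ z. f z \<partial>lborel)"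
    by (subst (1 2) nn_integral_lborel_complex(2))
       (auto intro!: nn_integral_cong nn_integral_lborel_translation[of "\<lambda>x. f (Complex _ x)"])
qed

text \<open>A rotation with \<open>sin \<theta> \<noteq> 0\<close> is a product of three shears, with the slope
  \<open>- tan (\<theta> / 2) = (cos \<theta> - 1) / sin \<theta>\<close> used twice.\<close>

lemma nn_integral_complex_rotation:
  fixes f :: "complex \<Rightarrow> ennreal"
  assumes f[measurable]: "f \<in> borel_measurable borel" and u: "cmod u = 1"
  shows "(\<integral>\<^sup>+ z. f (u * z) \<partial>lborel) = (\<integral>\<^sup>+ z. f z \<partial>lborel)"
proof -
  have rot: "(\<integral>\<^sup>+ z. f (u * z) \<partial>lborel) = (\<integral>\<^sup>+ z. f z \<partial>lborel)"
    if f[measurable]: "f \<in> borel_measurable borel" and u: "cmod u = 1" and "Im u \<noteq> 0"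
    for f :: "complex \<Rightarrow> ennreal" and u
  proof -
    define t where "t = (Re u - 1) / Im u"
    let ?X = "\<lambda>z. Complex (Re z + t * Im z) (Im z)"
    let ?Y = "\<lambda>z. Complex (Re z) (Im z + Im u * Re z)"
    have [measurable]: "?X \<in> borel_measurable borel" "?Y \<in> borel_measurable borel"
      by (auto intro!: borel_measurable_continuous_onI continuous_intros simp: Complex_eq)
    have eq: "(Re u)\<^sup>2 + (Im u)\<^sup>2 = 1"
      using u by (simp add: cmod_def)
    have t: "Im u * t = Re u - 1"
      using that by (simp add: t_def)
    \<comment> \<open>By |u| = 1, (Re u - 1)(Re u + 1) = -(Im u)^2; cancelling \<open>Im u\<close>
      yields the second relation needed to multiply out the three shears.\<close>
    have "Im u * (t * (Re u + 1)) = Im u * (- Im u)"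
      using eq t by algebra
    then have t2: "t * (Re u + 1) = - Im u"
      using \<open>Im u \<noteq> 0\<close> by (metis mult_left_cancel)
    have "?X (?Y (?X z)) = u * z" for z
    proof (rule complex_eqI)
      show "Re (?X (?Y (?X z))) = Re (u * z)"
        using t t2 by (simp, algebra)
      show "Im (?X (?Y (?X z))) = Im (u * z)"
        using t t2 by (simp, algebra)
    qed
    then have "(\<integral>\<^sup>+ z. f (u * z) \<partial>lborel) = (\<integral>\<^sup>+ z. f (?X (?Y (?X z))) \<partial>lborel)"
      by presburger
    also have "\<dots> = (\<integral>\<^sup>+ z. f (?X (?Y z)) \<partial>lborel)"
      by (rule nn_integral_complex_shear(1)[of "\<lambda>z. f (?X (?Y z))"]) measurable
    also have "\<dots> = (\<integral>\<^sup>+ z. f (?X z) \<partial>lborel)"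
      by (rule nn_integral_complex_shear(2)[of "\<lambda>z. f (?X z)"]) measurable
    also have "\<dots> = (\<integral>\<^sup>+ z. f z \<partial>lborel)"
      by (rule nn_integral_complex_shear(1)) measurable
    finally show ?thesis .
  qed
  show ?thesis
  proof (cases "Im u = 0")
    case False
    then show ?thesis using rot f u by blast
  next
    case True
    then have "\<bar>Re u\<bar> = 1"
      using u by (simp add: cmod_eq_Re)
    then consider "u = 1" | "u = -1"
      using True by (auto simp: complex_eq_iff abs_if split: if_splits)
    then show ?thesis
    proof cases
      case 2
      \<comment> \<open>The half turn escapes the shear factorisation, so it is split into two
        quarter turns, each covered by \<open>rot\<close>.\<close>
      have "(\<integral>\<^sup>+ z. f (u * z) \<partial>lborel) = (\<integral>\<^sup>+ z. f (\<i> * (\<i> * z)) \<partial>lborel)"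
        using 2 by (simp flip: mult.assoc)
      also have "\<dots> = (\<integral>\<^sup>+ z. f z \<partial>lborel)"
        using rot[of "\<lambda>z. f (\<i> * z)" \<i>] rot[of f \<i>] by simp
      finally show ?thesis .
    qed simp
  qed
qed

subsection \<open>Parseval's identity in the Fock space\<close>

text \<open>Orthogonality of the characters of the circle: for nonzero frequency the antiderivative
  is 2 pi periodic. Frequencies are integers because they arise as differences of exponents.\<close>

lemma has_integral_exp_int:
  fixes m :: int
  shows "((\<lambda>\<theta>. exp (\<i> * of_int m * of_real \<theta>)) has_integral (if m = 0 then of_real (2 * pi) else 0)) {0..2 * pi}"
proof (cases "m = 0")
  case True
  then show ?thesis
    using has_integral_const_real[of "1::complex" 0 "2 * pi"] by (simp add: scaleR_conv_of_real)
next
  case False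
  let ?F = "\<lambda>w. exp (\<i> * of_int m * w) / (\<i> * of_int m)"
  have "((\<lambda>\<theta>. exp (\<i> * of_int m * of_real \<theta>)) has_integral (?F (of_real (2 * pi)) - ?F (of_real 0))) {0..2 * pi}"
  proof (rule fundamental_theorem_of_calculus)
    fix x :: real
    have "(?F has_field_derivative exp (\<i> * of_int m * of_real x)) (at (of_real x))"
      using False by (auto intro!: derivative_eq_intros)
    then show "((\<lambda>\<theta>. ?F (of_real \<theta>)) has_vector_derivative exp (\<i> * of_int m * of_real x)) (at x within {0..2 * pi})"
      by (intro has_vector_derivative_real_field) 
  qed simp
  moreover have "exp (\<i> * of_int m * of_real (2 * pi)) = (1::complex)"
    using exp_integer_2pi[of "of_int m"] by (simp add: mult_ac)
  ultimately show ?thesis using False by simp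
qed

text \<open>The squared modulus expands to a double sum of \<open>b j * cnj (b k)\<close> times the
  character of frequency j - k; integration leaves only the diagonal.\<close>

lemma circle_parseval_polynomial:
  fixes b :: "nat \<Rightarrow> complex"
  shows "((\<lambda>\<theta>. (cmod (\<Sum>k<n. b k * cis \<theta> ^ k))\<^sup>2) has_integral (2 * pi * (\<Sum>k<n. (cmod (b k))\<^sup>2))) {0..2 * pi}"
proof -
  let ?e = "\<lambda>j k \<theta>. exp (\<i> * of_int (int j - int k) * of_real \<theta>)"
  have e: "?e j k \<theta> = cis \<theta> ^ j * cnj (cis \<theta> ^ k)" for j k \<theta>
  proof -
    have "cis \<theta> ^ j * cnj (cis \<theta> ^ k) = cis (of_int (int j - int k) * \<theta>)"
      by (simp add: cis_cnj Complex.DeMoivre cis_mult algebra_simps)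
    then show ?thesis
      by (simp add: cis_conv_exp mult_ac)
  qed
  have "((\<lambda>\<theta>. \<Sum>j<n. \<Sum>k<n. (b j * cnj (b k)) * ?e j k \<theta>) has_integral
         (\<Sum>j<n. \<Sum>k<n. (b j * cnj (b k)) * (if int j - int k = 0 then of_real (2 * pi) else 0))) {0..2 * pi}"
    by (intro has_integral_sum has_integral_mult_right has_integral_exp_int finite_lessThan)
  also have "(\<lambda>\<theta>. \<Sum>j<n. \<Sum>k<n. (b j * cnj (b k)) * ?e j k \<theta>)
      = (\<lambda>\<theta>. of_real ((cmod (\<Sum>k<n. b k * cis \<theta> ^ k))\<^sup>2))"
    unfolding e complex_norm_square cnj_sum sum_product by (simp add: mult_ac)
  also have "(\<Sum>j<n. \<Sum>k<n. (b j * cnj (b k)) * (if int j - int k = 0 then of_real (2 * pi) else 0))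
      = complex_of_real (2 * pi * (\<Sum>k<n. (cmod (b k))\<^sup>2))"
    by (simp add: if_distrib if_distribR complex_norm_square[unfolded of_real_power] sum_distrib_left mult_ac cong: if_cong)
  finally have "((\<lambda>\<theta>. complex_of_real ((cmod (\<Sum>k<n. b k * cis \<theta> ^ k))\<^sup>2)) has_integral
      complex_of_real (2 * pi * (\<Sum>k<n. (cmod (b k))\<^sup>2))) {0..2 * pi}" .
  from has_integral_linear[OF this bounded_linear_Re] show ?thesis
    by (simp only: o_def Re_complex_of_real)
qed

text \<open>Convergence at a point of strictly larger modulus, here the real number |z| + 1, forces
  absolute convergence at z.\<close>

lemma summable_norm_entire_series:
  fixes a :: "nat \<Rightarrow> complex"
  assumes "\<And>z. (\<lambda>k. a k * z ^ k) sums f z"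
  shows "summable (\<lambda>k. cmod (a k * z ^ k))"
proof (rule powser_insidea)
  show "summable (\<lambda>k. a k * (of_real (cmod z + 1)) ^ k)"
    using assms sums_summable by blast
  show "norm z < norm (complex_of_real (cmod z + 1))"
    by (simp only: norm_of_real)
qed

lemma holomorphic_entire_series:
  fixes a :: "nat \<Rightarrow> complex"
  assumes "\<And>z. (\<lambda>k. a k * z ^ k) sums f z"
  shows "f holomorphic_on UNIV"
proof -
  have "f holomorphic_on ball 0 r" for r
    using power_series_holomorphic[of 0 r a f] assms by simp
  then have "f field_differentiable at z" for z
    using holomorphic_on_imp_differentiable_at[of f "ball 0 (cmod z + 1)" z] by simp
  then show ?thesis
    by (simp add: holomorphic_on_def field_differentiable_at_within)
qed

text \<open>The squared partial sums are bounded, uniformly in the angle, by the square of the sum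
  of all \<open>cmod (b k)\<close>, so dominated convergence carries the polynomial identity to the
  limit.\<close>

lemma circle_parseval:
  fixes a :: "nat \<Rightarrow> complex"
  assumes f: "\<And>z. (\<lambda>k. a k * z ^ k) sums f z"
  shows "summable (\<lambda>k. (cmod (a k))\<^sup>2 * cmod z ^ (2 * k))"
    and "((\<lambda>\<theta>. (cmod (f (cis \<theta> * z)))\<^sup>2) has_integral (2 * pi * (\<Sum>k. (cmod (a k))\<^sup>2 * cmod z ^ (2 * k)))) {0..2 * pi}"
proof -
  define b where "b k = a k * z ^ k" for k
  let ?S = "\<lambda>n \<theta>. (cmod (\<Sum>k<n. b k * cis \<theta> ^ k))\<^sup>2"
  have b2: "(cmod (b k))\<^sup>2 = (cmod (a k))\<^sup>2 * cmod z ^ (2 * k)" for k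
    by (simp add: b_def norm_mult norm_power power_mult_distrib mult.commute flip: power_mult)
  have sb: "summable (\<lambda>k. cmod (b k))"
    unfolding b_def by (rule summable_norm_entire_series[OF f])
  have lim: "(\<lambda>n. ?S n \<theta>) \<longlonglongrightarrow> (cmod (f (cis \<theta> * z)))\<^sup>2" for \<theta>
  proof -
    have "(\<lambda>k. b k * cis \<theta> ^ k) sums f (cis \<theta> * z)"
      using f[of "cis \<theta> * z"] by (simp add: b_def power_mult_distrib mult_ac)
    then show ?thesis
      unfolding sums_def by (intro tendsto_intros)
  qed
  have bound: "norm (?S n \<theta>) \<le> (\<Sum>k. cmod (b k))\<^sup>2" for n \<theta>
  proof -
    have "cmod (\<Sum>k<n. b k * cis \<theta> ^ k) \<le> (\<Sum>k<n. cmod (b k))"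
      by (rule order.trans[OF norm_sum]) (simp add: norm_mult norm_power)
    also have "\<dots> \<le> (\<Sum>k. cmod (b k))"
      using sb by (intro sum_le_suminf) auto
    finally show ?thesis by (simp add: power_mono)
  qed
  have int: "?S n integrable_on {0..2 * pi}" "integral {0..2 * pi} (?S n) = 2 * pi * (\<Sum>k<n. (cmod (b k))\<^sup>2)" for n
    using circle_parseval_polynomial[where b = b and n = n] by (auto simp: integral_unique)
  have c: "(\<lambda>\<theta>. (cmod (f (cis \<theta> * z)))\<^sup>2) integrable_on {0..2 * pi}"
    "(\<lambda>n. integral {0..2 * pi} (?S n)) \<longlonglongrightarrow> integral {0..2 * pi} (\<lambda>\<theta>. (cmod (f (cis \<theta> * z)))\<^sup>2)"
    using dominated_convergence[of ?S "{0..2 * pi}" "\<lambda>_. (\<Sum>k. cmod (b k))\<^sup>2" "\<lambda>\<theta>. (cmod (f (cis \<theta> * z)))\<^sup>2"]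
      int(1) bound lim by auto
  \<comment> \<open>Dividing by 2 pi turns convergence of the integrals into convergence of the
    partial sums, which also yields summability.\<close>
  have "(\<lambda>n. (1 / (2 * pi)) * (2 * pi * (\<Sum>k<n. (cmod (b k))\<^sup>2))) \<longlonglongrightarrow> (1 / (2 * pi)) * integral {0..2 * pi} (\<lambda>\<theta>. (cmod (f (cis \<theta> * z)))\<^sup>2)"
    using c(2) unfolding int(2) by (rule tendsto_mult_left)
  then have s: "(\<lambda>k. (cmod (b k))\<^sup>2) sums ((1 / (2 * pi)) * integral {0..2 * pi} (\<lambda>\<theta>. (cmod (f (cis \<theta> * z)))\<^sup>2))"
    by (simp add: sums_def)
  then show "summable (\<lambda>k. (cmod (a k))\<^sup>2 * cmod z ^ (2 * k))"
    unfolding b2 by (rule sums_summable)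
  show "((\<lambda>\<theta>. (cmod (f (cis \<theta> * z)))\<^sup>2) has_integral (2 * pi * (\<Sum>k. (cmod (a k))\<^sup>2 * cmod z ^ (2 * k)))) {0..2 * pi}"
    using integrable_integral[OF c(1)] unfolding b2 sums_unique[OF s, unfolded b2, symmetric] by simp
qed

text \<open>The Gaussian weight is radial, so the norm integral may be averaged over all rotations.
  Tonelli then puts the circle integral inside, where \<open>circle_parseval\<close> separates the
  powers. Working in \<open>ennreal\<close> covers infinite norms as well.\<close>

lemma fock_parseval:
  fixes a :: "nat \<Rightarrow> complex"
  assumes f: "\<And>z. (\<lambda>k. a k * z ^ k) sums f z"
  shows "fock_sq_norm \<alpha> f = (\<Sum>k. ennreal ((cmod (a k))\<^sup>2) * fock_sq_norm \<alpha> (\<lambda>z. z ^ k))"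
proof -
  let ?w = "\<lambda>z. exp (- \<alpha> * (cmod z)\<^sup>2)"
  let ?I = "\<lambda>\<theta>. indicator {0..2 * pi} \<theta> :: ennreal"
  let ?g = "\<lambda>z. ennreal ((cmod (f z))\<^sup>2 * ?w z)"
  let ?t = "\<lambda>k z. ennreal ((cmod (z ^ k))\<^sup>2 * ?w z)"
  have cf: "continuous_on UNIV f"
    using holomorphic_entire_series[OF f] holomorphic_on_imp_continuous_on by blast
  have [measurable]: "f \<in> borel_measurable borel"
    using cf by (rule borel_measurable_continuous_onI)
  have [measurable]: "cis \<in> borel_measurable borel"
    by (intro borel_measurable_continuous_onI continuous_intros)
  have circ: "(\<integral>\<^sup>+ \<theta>. ?I \<theta> * ?g (cis \<theta> * z) \<partial>lborel) = ennreal (2 * pi) * (\<Sum>k. ennreal ((cmod (a k))\<^sup>2) * ?t k z)" for z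
  proof -
    have "(\<integral>\<^sup>+ \<theta>. ?I \<theta> * ?g (cis \<theta> * z) \<partial>lborel) = (\<integral>\<^sup>+ \<theta>. ennreal (?w z) * (ennreal ((cmod (f (cis \<theta> * z)))\<^sup>2) * ?I \<theta>) \<partial>lborel)"
      by (intro nn_integral_cong) (simp add: norm_mult ennreal_mult mult_ac)
    also have "\<dots> = ennreal (?w z) * (\<integral>\<^sup>+ \<theta>. ennreal ((cmod (f (cis \<theta> * z)))\<^sup>2) * ?I \<theta> \<partial>lborel)"
      by (rule nn_integral_cmult) measurable
    also have "(\<integral>\<^sup>+ \<theta>. ennreal ((cmod (f (cis \<theta> * z)))\<^sup>2) * ?I \<theta> \<partial>lborel)
        = ennreal (2 * pi * (\<Sum>k. (cmod (a k))\<^sup>2 * cmod z ^ (2 * k)))"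
      by (intro nn_integral_has_integral_lebesgue' circle_parseval(2)[OF f]) simp
    also have "\<dots> = ennreal (2 * pi) * (\<Sum>k. ennreal ((cmod (a k))\<^sup>2 * cmod z ^ (2 * k)))"
      using circle_parseval(1)[OF f, of z] by (subst suminf_ennreal2) (auto simp: ennreal_mult' suminf_nonneg)
    also have "ennreal (?w z) * \<dots> = ennreal (2 * pi) * (\<Sum>k. ennreal (?w z) * ennreal ((cmod (a k))\<^sup>2 * cmod z ^ (2 * k)))"
      by (simp add: mult_ac)
    also have "\<dots> = ennreal (2 * pi) * (\<Sum>k. ennreal ((cmod (a k))\<^sup>2) * ?t k z)"
      by (simp add: norm_power ennreal_mult mult_ac flip: power_mult)
    finally show ?thesis .
  qed
  have "ennreal (2 * pi) * (\<integral>\<^sup>+ z. ?g z \<partial>lborel) = (\<integral>\<^sup>+ \<theta>. ?I \<theta> * (\<integral>\<^sup>+ z. ?g z \<partial>lborel) \<partial>lborel)"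
    by (subst nn_integral_multc) (auto simp: nn_integral_indicator)
  also have "\<dots> = (\<integral>\<^sup>+ \<theta>. ?I \<theta> * (\<integral>\<^sup>+ z. ?g (cis \<theta> * z) \<partial>lborel) \<partial>lborel)"
    by (intro nn_integral_cong arg_cong2[of _ _ _ _ "(*)"] refl nn_integral_complex_rotation[of ?g, symmetric]) auto
  also have "\<dots> = (\<integral>\<^sup>+ \<theta>. (\<integral>\<^sup>+ z. ?I \<theta> * ?g (cis \<theta> * z) \<partial>lborel) \<partial>lborel)"
    by (intro nn_integral_cong nn_integral_cmult[symmetric]) measurable
  also have "\<dots> = (\<integral>\<^sup>+ z. (\<integral>\<^sup>+ \<theta>. ?I \<theta> * ?g (cis \<theta> * z) \<partial>lborel) \<partial>lborel)"
    by (rule lborel_pair.Fubini'[symmetric]) measurable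
  also have "\<dots> = (\<integral>\<^sup>+ z. ennreal (2 * pi) * (\<Sum>k. ennreal ((cmod (a k))\<^sup>2) * ?t k z) \<partial>lborel)"
    unfolding circ ..
  also have "\<dots> = ennreal (2 * pi) * (\<integral>\<^sup>+ z. (\<Sum>k. ennreal ((cmod (a k))\<^sup>2) * ?t k z) \<partial>lborel)"
    by (rule nn_integral_cmult) measurable
  also have "(\<integral>\<^sup>+ z. (\<Sum>k. ennreal ((cmod (a k))\<^sup>2) * ?t k z) \<partial>lborel) = (\<Sum>k. \<integral>\<^sup>+ z. ennreal ((cmod (a k))\<^sup>2) * ?t k z \<partial>lborel)"
    by (rule nn_integral_suminf) measurable
  also have "\<dots> = (\<Sum>k. ennreal ((cmod (a k))\<^sup>2) * (\<integral>\<^sup>+ z. ?t k z \<partial>lborel))"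
    by (intro suminf_cong nn_integral_cmult) measurable
  \<comment> \<open>The factor 2 pi is nonzero and finite, so it cancels in
    \<open>ennreal\<close>.\<close>
  finally have "(\<integral>\<^sup>+ z. ?g z \<partial>lborel) = (\<Sum>k. ennreal ((cmod (a k))\<^sup>2) * (\<integral>\<^sup>+ z. ?t k z \<partial>lborel))"
    by (simp add: ennreal_mult_cancel_left)
  then show ?thesis
    unfolding fock_sq_norm_def by (simp add: mult.left_commute flip: ennreal_suminf_cmult)
qed

section \<open>Norms of the monomials: positivity and finiteness\<close>

text \<open>The integrand vanishes at most at the origin, a null set; a zero integral would make
  Lebesgue measure on the plane trivial.\<close>

lemma fock_sq_norm_monomial_pos:
  assumes "\<alpha> > 0"
  shows "fock_sq_norm \<alpha> (\<lambda>z. z ^ k) > 0"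
proof -
  have "(\<integral>\<^sup>+ z. ennreal ((cmod (z ^ k))\<^sup>2 * exp (- \<alpha> * (cmod z)\<^sup>2)) \<partial>lborel) \<noteq> 0"
  proof
    assume "(\<integral>\<^sup>+ z. ennreal ((cmod (z ^ k))\<^sup>2 * exp (- \<alpha> * (cmod z)\<^sup>2)) \<partial>lborel) = 0"
    then have "AE z in (lborel :: complex measure). ennreal ((cmod (z ^ k))\<^sup>2 * exp (- \<alpha> * (cmod z)\<^sup>2)) = 0"
      by (subst (asm) nn_integral_0_iff_AE) auto
    moreover have "AE z in (lborel :: complex measure). z \<noteq> 0"
      by (rule AE_lborel_singleton)
    ultimately have "AE z in (lborel :: complex measure). False"
      by eventually_elim (auto simp: ennreal_eq_0_iff mult_le_0_iff)
    then show False
      using AE_E2 by (auto simp: ae_filter_eq_bot_iff trivial_limit_def[symmetric])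
  qed
  then show ?thesis
    using assms by (simp add: fock_sq_norm_def zero_less_iff_neq_zero)
qed

text \<open>The integrand is a multiple of the normal density with mean 0 and variance 1 / (2
  \<beta>).\<close>

lemma nn_integral_gaussian_finite:
  assumes "(\<beta>::real) > 0"
  shows "(\<integral>\<^sup>+ x. ennreal (exp (- \<beta> * x\<^sup>2)) \<partial>lborel) < \<infinity>"
proof -
  define \<sigma> where "\<sigma> = sqrt (1 / (2 * \<beta>))"
  have s: "\<sigma> > 0" "\<sigma>\<^sup>2 = 1 / (2 * \<beta>)"
    using assms by (auto simp: \<sigma>_def)
  have "integrable lborel (\<lambda>x. sqrt (2 * pi * \<sigma>\<^sup>2) * normal_density 0 \<sigma> x)"
    using s by (intro integrable_mult_right integrable_normal_density)
  also have "(\<lambda>x. sqrt (2 * pi * \<sigma>\<^sup>2) * normal_density 0 \<sigma> x) = (\<lambda>x. exp (- \<beta> * x\<^sup>2))"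
    using s assms by (auto simp: normal_density_def fun_eq_iff)
  finally show ?thesis
    by (simp add: integrable_iff_bounded)
qed

text \<open>Half of the Gaussian decay absorbs the power of |z|; the other half is integrable
  because it factors over real and imaginary parts.\<close>

lemma fock_sq_norm_monomial_finite:
  assumes "\<alpha> > 0"
  shows "fock_sq_norm \<alpha> (\<lambda>z. z ^ k) < \<infinity>"
proof -
  define \<beta> where "\<beta> = \<alpha> / 2"
  have \<beta>: "\<beta> > 0" "\<alpha> = \<beta> + \<beta>" using assms by (auto simp: \<beta>_def)
  define C where "C = fact k / \<beta> ^ k"
  have C: "C \<ge> 0" using \<beta> by (simp add: C_def)
  have *: "x ^ k * exp (- \<alpha> * x) \<le> C * exp (- \<beta> * x)" if "x \<ge> 0" for x
  proof -
    \<comment> \<open>A single term of the exponential series is at most the whole; solving for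
      \<open>x ^ k\<close> produces the constant \<open>C\<close>.\<close>
    have "(\<beta> * x) ^ k / fact k \<le> exp (\<beta> * x)"
      using that \<beta> sum_le_suminf[of "\<lambda>n. (\<beta> * x) ^ n /\<^sub>R fact n" "{k}"]
        summable_exp_generic[of "\<beta> * x"]
      by (simp add: exp_def divide_inverse mult.commute)
    then have "x ^ k \<le> C * exp (\<beta> * x)"
      using \<beta> by (simp add: C_def field_simps)
    then have "x ^ k * exp (- \<alpha> * x) \<le> C * exp (\<beta> * x) * exp (- \<alpha> * x)"
      by (intro mult_right_mono) auto
    also have "\<dots> = C * exp (- \<beta> * x)"
      by (simp add: \<beta>(2) algebra_simps flip: exp_add)
    finally show ?thesis .
  qed
  have "(\<integral>\<^sup>+ z. ennreal ((cmod (z ^ k))\<^sup>2 * exp (- \<alpha> * (cmod z)\<^sup>2)) \<partial>lborel)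
      \<le> (\<integral>\<^sup>+ z. ennreal (C * exp (- \<beta> * (cmod z)\<^sup>2)) \<partial>lborel)"
  proof (intro nn_integral_mono ennreal_leI)
    fix z
    show "(cmod (z ^ k))\<^sup>2 * exp (- \<alpha> * (cmod z)\<^sup>2) \<le> C * exp (- \<beta> * (cmod z)\<^sup>2)"
      using *[of "(cmod z)\<^sup>2"] by (simp add: norm_power mult.commute flip: power_mult)
  qed
  also have "\<dots> = ennreal C * (\<integral>\<^sup>+ z. ennreal (exp (- \<beta> * (cmod z)\<^sup>2)) \<partial>lborel)"
    using C by (simp add: ennreal_mult nn_integral_cmult)
  also have "(\<integral>\<^sup>+ z. ennreal (exp (- \<beta> * (cmod z)\<^sup>2)) \<partial>lborel)
     = (\<integral>\<^sup>+ z. (\<Prod>b\<in>Basis. ennreal (exp (- \<beta> * (z \<bullet> b)\<^sup>2))) \<partial>(lborel :: complex measure))"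
    by (intro nn_integral_cong)
       (simp add: Basis_complex_def inner_complex_def cmod_power2 algebra_simps exp_add ennreal_mult flip: ennreal_mult exp_add)
  also have "\<dots> = (\<Prod>b\<in>(Basis::complex set). \<integral>\<^sup>+ x. ennreal (exp (- \<beta> * x\<^sup>2)) \<partial>lborel)"
    by (rule nn_integral_lborel_prod) auto
  also have "ennreal C * \<dots> < \<infinity>"
    using nn_integral_gaussian_finite[OF \<beta>(1)]
    by (simp add: ennreal_mult_less_top Basis_complex_def)
  finally show ?thesis
    by (simp add: fock_sq_norm_def ennreal_mult_less_top)
qed

section \<open>Power series coefficients of entire functions\<close>

text \<open>A relation, so that norms can be read off from any known expansion; convergence at every
  point builds in that f is entire.\<close>

definition entire_coeffs :: "(nat \<Rightarrow> complex) \<Rightarrow> (complex \<Rightarrow> complex) \<Rightarrow> bool" where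
  "entire_coeffs a f \<longleftrightarrow> (\<forall>z. (\<lambda>k. a k * z ^ k) sums f z)"

definition taylor_coeff :: "(complex \<Rightarrow> complex) \<Rightarrow> nat \<Rightarrow> complex" where
  "taylor_coeff f k = (deriv ^^ k) f 0 / fact k"

text \<open>For positive \<alpha> the conversion to a real loses nothing, by
  \<open>fock_sq_norm_monomial_finite\<close>, and it permits ordinary summability
  arguments.\<close>

definition fock_weight :: "real \<Rightarrow> nat \<Rightarrow> real" where
  "fock_weight \<alpha> k = enn2real (fock_sq_norm \<alpha> (\<lambda>z. z ^ k))"

lemma entire_coeffs_taylor_coeff:
  assumes "f \<in> fock_space \<alpha>"
  shows "entire_coeffs (taylor_coeff f) f"
  unfolding entire_coeffs_def taylor_coeff_def
proof
  fix z
  have "f holomorphic_on ball 0 (cmod z + 1)"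
    using assms by (auto simp: fock_space_def intro: holomorphic_on_subset)
  from holomorphic_power_series[OF this, of z]
  show "(\<lambda>k. (deriv ^^ k) f 0 / fact k * z ^ k) sums f z" by simp
qed

text \<open>Together with \<open>taylor_coeff_cmult\<close>, this makes the truncation
  \<open>trunc\<close> below a linear operator.\<close>

lemma taylor_coeff_add:
  assumes "f \<in> fock_space \<alpha>" "g \<in> fock_space \<alpha>"
  shows "taylor_coeff (\<lambda>z. f z + g z) k = taylor_coeff f k + taylor_coeff g k"
  using assms higher_deriv_add[of f UNIV g 0 k]
  by (simp add: taylor_coeff_def fock_space_def add_divide_distrib)

lemma taylor_coeff_cmult:
  assumes "f \<in> fock_space \<alpha>"
  shows "taylor_coeff (\<lambda>z. c * f z) k = c * taylor_coeff f k"
  using assms higher_deriv_cmult[of f UNIV 0 k c]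
  by (simp add: taylor_coeff_def fock_space_def)

lemma entire_coeffs_add:
  "entire_coeffs a f \<Longrightarrow> entire_coeffs b g \<Longrightarrow> entire_coeffs (\<lambda>k. a k + b k) (\<lambda>z. f z + g z)"
  by (auto simp: entire_coeffs_def distrib_right intro: sums_add)

lemma entire_coeffs_diff:
  "entire_coeffs a f \<Longrightarrow> entire_coeffs b g \<Longrightarrow> entire_coeffs (\<lambda>k. a k - b k) (\<lambda>z. f z - g z)"
  by (auto simp: entire_coeffs_def left_diff_distrib intro: sums_diff)

lemma entire_coeffs_cmult:
  "entire_coeffs a f \<Longrightarrow> entire_coeffs (\<lambda>k. c * a k) (\<lambda>z. c * f z)"
  by (auto simp: entire_coeffs_def mult.assoc intro: sums_mult)

lemma entire_coeffs_polynomial: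
  "entire_coeffs (\<lambda>k. if k < n then c k else 0) (\<lambda>z. \<Sum>k<n. c k * z ^ k)"
  unfolding entire_coeffs_def
proof
  fix z
  show "(\<lambda>k. (if k < n then c k else 0) * z ^ k) sums (\<Sum>k<n. c k * z ^ k)"
    using sums_If_finite_set[of "{..<n}" "\<lambda>k. c k * z ^ k"]
    by (simp add: if_distrib[of "\<lambda>x. x * _"] cong: if_cong)
qed

lemma entire_coeffs_unique:
  "entire_coeffs a f \<Longrightarrow> entire_coeffs a g \<Longrightarrow> f = g"
  by (auto simp: entire_coeffs_def fun_eq_iff intro: sums_unique2)

lemma fock_norm_nonneg: "fock_norm \<alpha> f \<ge> 0"
  by (simp add: fock_norm_def)

section \<open>The Fock norm as a weighted square sum of coefficients\<close>

context
  fixes \<alpha> :: real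
  assumes \<alpha>: "\<alpha> > 0"
begin

lemma ennreal_fock_weight: "ennreal (fock_weight \<alpha> k) = fock_sq_norm \<alpha> (\<lambda>z. z ^ k)"
  using fock_sq_norm_monomial_finite[OF \<alpha>, of k] by (simp add: fock_weight_def)

lemma fock_weight_pos: "fock_weight \<alpha> k > 0"
  using fock_sq_norm_monomial_pos[OF \<alpha>, of k] fock_sq_norm_monomial_finite[OF \<alpha>, of k]
  by (simp add: fock_weight_def enn2real_positive_iff)

lemma fock_weight_nonneg: "fock_weight \<alpha> k \<ge> 0"
  using fock_weight_pos[of k] by simp

lemma fock_sq_norm_series:
  assumes "entire_coeffs a f"
  shows "fock_sq_norm \<alpha> f = (\<Sum>k. ennreal ((cmod (a k))\<^sup>2 * fock_weight \<alpha> k))"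
  using fock_parseval[of a f \<alpha>] assms
  by (simp add: entire_coeffs_def ennreal_mult fock_weight_nonneg ennreal_fock_weight)

text \<open>An everywhere convergent power series is holomorphic, so only finiteness of the Parseval
  sum remains to be tested.\<close>

lemma fock_space_iff_summable:
  assumes "entire_coeffs a f"
  shows "f \<in> fock_space \<alpha> \<longleftrightarrow> summable (\<lambda>k. (cmod (a k))\<^sup>2 * fock_weight \<alpha> k)"
proof -
  have "f holomorphic_on UNIV"
    using holomorphic_entire_series assms by (auto simp: entire_coeffs_def)
  then have "f \<in> fock_space \<alpha> \<longleftrightarrow> (\<Sum>k. ennreal ((cmod (a k))\<^sup>2 * fock_weight \<alpha> k)) \<noteq> top"
    by (simp add: fock_space_def fock_sq_norm_series[OF assms] less_top)
  also have "\<dots> \<longleftrightarrow> summable (\<lambda>k. (cmod (a k))\<^sup>2 * fock_weight \<alpha> k)"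
  proof
    show "summable (\<lambda>k. (cmod (a k))\<^sup>2 * fock_weight \<alpha> k)"
      if "(\<Sum>k. ennreal ((cmod (a k))\<^sup>2 * fock_weight \<alpha> k)) \<noteq> top"
      using that by (intro summable_suminf_not_top) (auto simp: fock_weight_nonneg)
    show "(\<Sum>k. ennreal ((cmod (a k))\<^sup>2 * fock_weight \<alpha> k)) \<noteq> top"
      if "summable (\<lambda>k. (cmod (a k))\<^sup>2 * fock_weight \<alpha> k)"
      using that by (intro ennreal_suminf_neq_top) (auto simp: fock_weight_nonneg)
  qed
  finally show ?thesis .
qed

lemma fock_norm_series:
  assumes "entire_coeffs a f" "f \<in> fock_space \<alpha>"
  shows "(\<lambda>k. (cmod (a k))\<^sup>2 * fock_weight \<alpha> k) sums (fock_norm \<alpha> f)\<^sup>2"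
proof -
  have s: "summable (\<lambda>k. (cmod (a k))\<^sup>2 * fock_weight \<alpha> k)"
    using assms fock_space_iff_summable by blast
  have "fock_sq_norm \<alpha> f = ennreal (\<Sum>k. (cmod (a k))\<^sup>2 * fock_weight \<alpha> k)"
    unfolding fock_sq_norm_series[OF assms(1)]
    using s fock_weight_nonneg by (intro suminf_ennreal2) auto
  moreover have "0 \<le> (\<Sum>k. (cmod (a k))\<^sup>2 * fock_weight \<alpha> k)"
    using s fock_weight_nonneg by (intro suminf_nonneg) auto
  ultimately have "(fock_norm \<alpha> f)\<^sup>2 = (\<Sum>k. (cmod (a k))\<^sup>2 * fock_weight \<alpha> k)"
    by (simp add: fock_norm_def)
  then show ?thesis using s by (simp add: summable_sums)
qed

lemma fock_normI:
  assumes "entire_coeffs a f" "summable (\<lambda>k. (cmod (a k))\<^sup>2 * fock_weight \<alpha> k)"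
    and "(\<Sum>k. (cmod (a k))\<^sup>2 * fock_weight \<alpha> k) \<le> C\<^sup>2" "C \<ge> 0"
  shows "f \<in> fock_space \<alpha>" "fock_norm \<alpha> f \<le> C"
proof -
  show f: "f \<in> fock_space \<alpha>"
    using assms fock_space_iff_summable by blast
  have "(fock_norm \<alpha> f)\<^sup>2 \<le> C\<^sup>2"
    using sums_unique[OF fock_norm_series[OF assms(1) f]] assms(3) by simp
  then show "fock_norm \<alpha> f \<le> C"
    using \<open>C \<ge> 0\<close> power2_le_imp_le by blast
qed

lemma polynomial_in_fock_space: "(\<lambda>z. \<Sum>k<n. c k * z ^ k) \<in> fock_space \<alpha>"
  unfolding fock_space_iff_summable[OF entire_coeffs_polynomial]
  by (rule summable_finite[of "{..<n}"]) auto

lemma monomial_in_fock_space: "(\<lambda>z. c * z ^ i) \<in> fock_space \<alpha>"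
  using polynomial_in_fock_space[of "\<lambda>k. if k = i then c else 0" "Suc i"]
  by (simp add: if_distribR cong: if_cong)

text \<open>Serves to normalise a test polynomial in the lower bound for the singular
  values.\<close>

lemma fock_norm_scale:
  assumes "s \<ge> 0" "f \<in> fock_space \<alpha>"
  shows "fock_norm \<alpha> (\<lambda>z. of_real s * f z) = s * fock_norm \<alpha> f"
proof -
  have *: "(\<lambda>k. s\<^sup>2 * ((cmod (taylor_coeff f k))\<^sup>2 * fock_weight \<alpha> k)) sums (s\<^sup>2 * (fock_norm \<alpha> f)\<^sup>2)"
    by (intro sums_mult fock_norm_series[OF entire_coeffs_taylor_coeff[OF assms(2)] assms(2)])
  have e: "entire_coeffs (\<lambda>k. of_real s * taylor_coeff f k) (\<lambda>z. of_real s * f z)"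
    by (intro entire_coeffs_cmult entire_coeffs_taylor_coeff[OF assms(2)])
  have eq: "(\<lambda>k. (cmod (of_real s * taylor_coeff f k))\<^sup>2 * fock_weight \<alpha> k) = (\<lambda>k. s\<^sup>2 * ((cmod (taylor_coeff f k))\<^sup>2 * fock_weight \<alpha> k))"
    by (simp add: norm_mult power_mult_distrib mult_ac)
  have "(\<lambda>z. of_real s * f z) \<in> fock_space \<alpha>"
    using fock_space_iff_summable[OF e] sums_summable[OF *] by (simp add: eq)
  then have "(fock_norm \<alpha> (\<lambda>z. of_real s * f z))\<^sup>2 = (s * fock_norm \<alpha> f)\<^sup>2"
    using sums_unique2[OF fock_norm_series[OF e, unfolded eq] *] by (simp add: power_mult_distrib)
  then show ?thesis
    using assms fock_norm_nonneg by (simp add: power2_eq_iff_nonneg)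
qed

end

section \<open>Linear algebra for operators of finite rank\<close>

lemma linear_op_add:
  "fock_linear_op \<alpha> R \<Longrightarrow> f \<in> fock_space \<alpha> \<Longrightarrow> g \<in> fock_space \<alpha> \<Longrightarrow>
    R (\<lambda>z. f z + g z) = (\<lambda>z. R f z + R g z)"
  unfolding fock_linear_op_def by blast

lemma linear_op_cmult:
  "fock_linear_op \<alpha> R \<Longrightarrow> f \<in> fock_space \<alpha> \<Longrightarrow> R (\<lambda>z. c * f z) = (\<lambda>z. c * R f z)"
  unfolding fock_linear_op_def by blast

text \<open>Linearity is granted only for arguments inside the Fock space, so each partial sum and
  each scaled term must lie there before the induction can split it off.\<close>

lemma linear_op_sum:
  fixes N :: nat
  assumes R: "fock_linear_op \<alpha> R" and e: "\<And>i. i < N \<Longrightarrow> e i \<in> fock_space \<alpha>"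
    and fin: "\<And>n. n \<le> N \<Longrightarrow> (\<lambda>z. \<Sum>i<n. c i * e i z) \<in> fock_space \<alpha>"
    and ce: "\<And>i. i < N \<Longrightarrow> (\<lambda>z. c i * e i z) \<in> fock_space \<alpha>"
  shows "R (\<lambda>z. \<Sum>i<N. c i * e i z) = (\<lambda>z. \<Sum>i<N. c i * R (e i) z)"
proof -
  have "R (\<lambda>z. \<Sum>i<n. c i * e i z) = (\<lambda>z. \<Sum>i<n. c i * R (e i) z)" if "n \<le> N" for n
    using that
  proof (induction n)
    case 0
    have z: "(\<lambda>z. 0) \<in> fock_space \<alpha>"
      using fin[of 0] by simp
    from linear_op_cmult[OF R z, of 0] show ?case by simp
  next
    case (Suc n)
    then have "R (\<lambda>z. (\<Sum>i<n. c i * e i z) + c n * e n z)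
        = (\<lambda>z. R (\<lambda>z. \<Sum>i<n. c i * e i z) z + R (\<lambda>z. c n * e n z) z)"
      by (intro linear_op_add[OF R] fin ce) auto
    also have "R (\<lambda>z. c n * e n z) = (\<lambda>z. c n * R (e n) z)"
      using Suc.prems by (intro linear_op_cmult[OF R] e) simp
    also have "R (\<lambda>z. \<Sum>i<n. c i * e i z) = (\<lambda>z. \<Sum>i<n. c i * R (e i) z)"
      using Suc by simp
    finally show ?case by simp
  qed
  then show ?thesis by simp
qed

text \<open>A homogeneous system with more unknowns than equations, solved by Gaussian elimination:
  the induction removes one column and one pivot row at a time.\<close>

lemma exists_left_kernel_vector:
  fixes A :: "'i \<Rightarrow> nat \<Rightarrow> 'a::field"
  assumes "finite I" "card I > n"
  shows "\<exists>c. (\<exists>i\<in>I. c i \<noteq> 0) \<and> (\<forall>j<n. (\<Sum>i\<in>I. c i * A i j) = 0)"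
  using assms
proof (induction n arbitrary: I A)
  case 0
  then have "I \<noteq> {}" by auto
  then show ?case by (intro exI[of _ "\<lambda>_. 1"]) auto
next
  case (Suc n)
  show ?case
  proof (cases "\<exists>q\<in>I. A q n \<noteq> 0")
    case False
    then show ?thesis
      using Suc.IH[of I A] Suc.prems by (auto simp: less_Suc_eq)
  next
    case True
    then obtain q where q: "q \<in> I" "A q n \<noteq> 0" by blast
    \<comment> \<open>Column n is cleared with the pivot row q; the induction hypothesis then
      handles the other rows and the first n columns.\<close>
    define B where "B i j = A i j - A i n / A q n * A q j" for i j
    obtain c where c: "\<exists>i\<in>I - {q}. c i \<noteq> 0" "\<And>j. j < n \<Longrightarrow> (\<Sum>i\<in>I - {q}. c i * B i j) = 0"
    proof -
      have "card (I - {q}) > n" using Suc.prems q by (simp add: card_Diff_singleton)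
      then show ?thesis using Suc.IH[of "I - {q}" B] Suc.prems that by auto
    qed
    have cn: "(\<Sum>i\<in>I - {q}. c i * B i j) = 0" if "j < Suc n" for j
      using c(2)[of j] that q by (cases "j = n") (auto simp: B_def)
    \<comment> \<open>The entry at q collects the multiples of the pivot row subtracted in
      \<open>B\<close>, so that the combination of rows of \<open>A\<close> equals that of rows of
      \<open>B\<close>.\<close>
    define d where "d = c(q := - (\<Sum>i\<in>I - {q}. c i * A i n) / A q n)"
    have "(\<Sum>i\<in>I. d i * A i j) = 0" if "j < Suc n" for j
    proof -
      have "(\<Sum>i\<in>I. d i * A i j) = d q * A q j + (\<Sum>i\<in>I - {q}. c i * A i j)"
        using Suc.prems q by (simp add: sum.remove d_def)
      also have "\<dots> = (\<Sum>i\<in>I - {q}. c i * B i j)"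
        by (simp add: d_def B_def right_diff_distrib sum_subtractf sum_divide_distrib sum_distrib_right sum_distrib_left mult_ac)
      finally show ?thesis using cn[OF that] by simp
    qed
    moreover have "\<exists>i\<in>I. d i \<noteq> 0"
      using c(1) by (auto simp: d_def)
    ultimately show ?thesis by blast
  qed
qed

subsection \<open>Diagonal operators\<close>

text \<open>\<open>T_coeffs\<close> speaks about all entire functions, so T f has a known expansion
  before it is shown to lie in the Fock space. Monotonicity makes \<open>m n\<close> the largest
  multiplier from index n on.\<close>

locale fock_diagonal =
  fixes \<alpha> :: real and m :: "nat \<Rightarrow> real" and T :: "(complex \<Rightarrow> complex) \<Rightarrow> (complex \<Rightarrow> complex)"
  assumes \<alpha>: "\<alpha> > 0"
    and m_nonneg: "m n \<ge> 0"
    and m_decseq: "decseq m"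
    and T_coeffs: "entire_coeffs a f \<Longrightarrow> entire_coeffs (\<lambda>k. of_real (m k) * a k) (T f)"
begin

abbreviation "w \<equiv> fock_weight \<alpha>"

lemma m_le: "n \<le> k \<Longrightarrow> m k \<le> m n"
  using m_decseq by (simp add: decseq_def)

text \<open>From index n on all multipliers are at most \<open>m n\<close>, so the Parseval sums
  compare term by term. The case n = 0 gives boundedness of T, general n the truncation
  error.\<close>

lemma tail_norm:
  assumes f: "f \<in> fock_space \<alpha>" and a: "entire_coeffs a f"
    and g: "entire_coeffs (\<lambda>k. if k < n then 0 else of_real (m k) * a k) g"
  shows "g \<in> fock_space \<alpha>" "fock_norm \<alpha> g \<le> m n * fock_norm \<alpha> f"
proof -
  let ?b = "\<lambda>k. if k < n then 0 else of_real (m k) * a k"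
  have s: "(\<lambda>k. (m n)\<^sup>2 * ((cmod (a k))\<^sup>2 * w k)) sums ((m n)\<^sup>2 * (fock_norm \<alpha> f)\<^sup>2)"
    by (intro sums_mult fock_norm_series[OF \<alpha> a f])
  have le: "(cmod (?b k))\<^sup>2 * w k \<le> (m n)\<^sup>2 * ((cmod (a k))\<^sup>2 * w k)" for k
  proof (cases "k < n")
    case False
    then have "(m k)\<^sup>2 \<le> (m n)\<^sup>2"
      using m_le[of n k] m_nonneg by (intro power_mono) auto
    then show ?thesis
      using False fock_weight_nonneg[OF \<alpha>]
      by (simp add: norm_mult power_mult_distrib mult.assoc mult_right_mono)
  qed (simp add: fock_weight_nonneg[OF \<alpha>])
  have sb: "summable (\<lambda>k. (cmod (?b k))\<^sup>2 * w k)"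
  proof (rule summable_comparison_test')
    show "summable (\<lambda>k. (m n)\<^sup>2 * ((cmod (a k))\<^sup>2 * w k))"
      using s sums_summable by blast
    show "norm ((cmod (?b k))\<^sup>2 * w k) \<le> (m n)\<^sup>2 * ((cmod (a k))\<^sup>2 * w k)" if "k \<ge> 0" for k
      using le[of k] fock_weight_nonneg[OF \<alpha>, of k] by simp
  qed
  have "(\<Sum>k. (cmod (?b k))\<^sup>2 * w k) \<le> (m n * fock_norm \<alpha> f)\<^sup>2"
    unfolding power_mult_distrib sums_unique[OF s]
    by (rule suminf_le[OF le sb sums_summable[OF s]])
  then show "g \<in> fock_space \<alpha>" "fock_norm \<alpha> g \<le> m n * fock_norm \<alpha> f"
    using fock_normI[OF \<alpha> g sb] m_nonneg fock_norm_nonneg by auto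
qed

lemma T_in_fock_space:
  assumes "f \<in> fock_space \<alpha>"
  shows "T f \<in> fock_space \<alpha>"
  using tail_norm(1)[where n = 0, OF assms entire_coeffs_taylor_coeff[OF assms]]
    T_coeffs[OF entire_coeffs_taylor_coeff[OF assms]] by simp

lemma T_linear: "fock_linear_op \<alpha> T"
  unfolding fock_linear_op_def
proof (intro conjI ballI allI)
  fix f g assume f: "f \<in> fock_space \<alpha>" and g: "g \<in> fock_space \<alpha>"
  note c = entire_coeffs_taylor_coeff[OF f] entire_coeffs_taylor_coeff[OF g]
  show "T (\<lambda>z. f z + g z) = (\<lambda>z. T f z + T g z)"
    using T_coeffs[OF entire_coeffs_add[OF c]] entire_coeffs_add[OF T_coeffs[OF c(1)] T_coeffs[OF c(2)]]
    by (intro entire_coeffs_unique) (auto simp: distrib_left)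
next
  fix f c assume f: "f \<in> fock_space \<alpha>"
  note a = entire_coeffs_taylor_coeff[OF f]
  show "T (\<lambda>z. c * f z) = (\<lambda>z. c * T f z)"
    using T_coeffs[OF entire_coeffs_cmult[OF a]] entire_coeffs_cmult[OF T_coeffs[OF a]]
    by (intro entire_coeffs_unique) (auto simp: mult.left_commute)
qed (rule T_in_fock_space)

section \<open>Singular values of a diagonal operator\<close>

text \<open>T followed by the projection onto polynomials of degree below n: a competitor in the
  infimum defining the n-th singular value, which will turn out to be optimal.\<close>

definition trunc :: "nat \<Rightarrow> (complex \<Rightarrow> complex) \<Rightarrow> complex \<Rightarrow> complex" where
  "trunc n f = (\<lambda>z. \<Sum>k<n. (of_real (m k) * taylor_coeff f k) * z ^ k)"

lemma trunc_rank: "fock_rank_le \<alpha> n (trunc n)"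
  unfolding fock_rank_le_def
proof
  show "fock_linear_op \<alpha> (trunc n)"
    unfolding fock_linear_op_def trunc_def
    by (intro conjI ballI allI polynomial_in_fock_space[OF \<alpha>])
       (simp_all add: taylor_coeff_add taylor_coeff_cmult sum.distrib sum_distrib_left algebra_simps)
  have "(\<lambda>z. z ^ i) \<in> fock_space \<alpha>" for i
    using monomial_in_fock_space[OF \<alpha>, of 1] by simp
  then show "\<exists>g. (\<forall>i<n. g i \<in> fock_space \<alpha>) \<and>
      (\<forall>f\<in>fock_space \<alpha>. \<exists>a. trunc n f = (\<lambda>z. \<Sum>i<n. a i * g i z))"
    unfolding trunc_def
    by (intro exI[of _ "\<lambda>i z. z ^ i"] conjI allI impI ballI exI) auto
qed

lemma T_minus_trunc:
  assumes f: "f \<in> fock_space \<alpha>"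
  shows "fock_norm \<alpha> (\<lambda>z. T f z - trunc n f z) \<le> m n * fock_norm \<alpha> f"
proof (rule tail_norm(2)[OF f entire_coeffs_taylor_coeff[OF f]])
  have "entire_coeffs (\<lambda>k. of_real (m k) * taylor_coeff f k - (if k < n then of_real (m k) * taylor_coeff f k else 0))
        (\<lambda>z. T f z - trunc n f z)"
    unfolding trunc_def
    by (intro entire_coeffs_diff T_coeffs entire_coeffs_polynomial entire_coeffs_taylor_coeff[OF f])
  then show "entire_coeffs (\<lambda>k. if k < n then 0 else of_real (m k) * taylor_coeff f k) (\<lambda>z. T f z - trunc n f z)"
    by (rule back_subst[of "\<lambda>c. entire_coeffs c _"]) auto
qed

text \<open>\<open>trunc n\<close> is an admissible competitor whose error on the unit ball is at
  most \<open>m n\<close>.\<close>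

lemma sing_val_le: "fock_sing_val \<alpha> T n \<le> ennreal (m n)"
  unfolding fock_sing_val_def
proof (rule INF_lower2[of "trunc n"])
  show "fock_op_norm \<alpha> (\<lambda>f z. T f z - trunc n f z) \<le> ennreal (m n)"
    unfolding fock_op_norm_def
  proof (rule SUP_least, rule ennreal_leI)
    fix f assume "f \<in> {f \<in> fock_space \<alpha>. fock_norm \<alpha> f \<le> 1}"
    then show "fock_norm \<alpha> (\<lambda>z. T f z - trunc n f z) \<le> m n"
      using T_minus_trunc[of f n] mult_left_mono[of "fock_norm \<alpha> f" 1 "m n"] m_nonneg[of n] by auto
  qed
qed (simp add: trunc_rank)

text \<open>An operator of rank at most \<open>n\<close> kills some nonzero polynomial of degree at most \<open>n\<close>,
  and \<open>T\<close> expands the norm of such a polynomial by a factor of at least \<open>m n\<close>.\<close>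

lemma sing_val_ge: "ennreal (m n) \<le> fock_sing_val \<alpha> T n"
  unfolding fock_sing_val_def
proof (rule INF_greatest)
  fix R assume "R \<in> {R. fock_rank_le \<alpha> n R}"
  then have R: "fock_linear_op \<alpha> R" and "\<exists>g. (\<forall>i<n. g i \<in> fock_space \<alpha>) \<and>
      (\<forall>f\<in>fock_space \<alpha>. \<exists>a. R f = (\<lambda>z. \<Sum>i<n. a i * g i z))"
    by (auto simp: fock_rank_le_def)
  then obtain g where g: "\<forall>f\<in>fock_space \<alpha>. \<exists>a. R f = (\<lambda>z. \<Sum>i<n. a i * g i z)"
    by blast
  have mon: "(\<lambda>z. z ^ i) \<in> fock_space \<alpha>" "(\<lambda>z. c * z ^ i) \<in> fock_space \<alpha>" for i c
    using monomial_in_fock_space[OF \<alpha>] monomial_in_fock_space[OF \<alpha>, of 1] by simp_all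
  \<comment> \<open>The rank bound writes every image of a monomial in the same n functions;
    \<open>A\<close> is the matrix of these combinations.\<close>
  have "\<forall>i. \<exists>a. R (\<lambda>z. z ^ i) = (\<lambda>z. \<Sum>j<n. a j * g j z)"
    using bspec[OF g mon(1)] by (rule allI)
  from choice[OF this]
  obtain A where A: "\<And>i. R (\<lambda>z. z ^ i) = (\<lambda>z. \<Sum>j<n. A i j * g j z)"
    by (auto simp only:)
  \<comment> \<open>The n + 1 monomials of degree at most n face only n linear conditions.\<close>
  obtain c where c0: "\<exists>i\<in>{..n}. c i \<noteq> 0" and c: "\<And>j. j < n \<Longrightarrow> (\<Sum>i\<in>{..n}. c i * A i j) = 0"
    using exists_left_kernel_vector[of "{..n}" n A] by auto
  define q where "q = (\<lambda>z. \<Sum>i<Suc n. c i * z ^ i)"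
  have qF: "q \<in> fock_space \<alpha>"
    unfolding q_def by (rule polynomial_in_fock_space[OF \<alpha>])
  have qc: "entire_coeffs (\<lambda>k. if k < Suc n then c k else 0) q"
    unfolding q_def by (rule entire_coeffs_polynomial)
  have Rq: "R q = (\<lambda>z. 0)"
  proof -
    have "R q = (\<lambda>z. \<Sum>i<Suc n. c i * R (\<lambda>z. z ^ i) z)"
      unfolding q_def by (intro linear_op_sum[OF R] mon polynomial_in_fock_space[OF \<alpha>])
    also have "\<dots> = (\<lambda>z. \<Sum>j<n. (\<Sum>i\<in>{..n}. c i * A i j) * g j z)"
      unfolding A sum_distrib_left sum_distrib_right lessThan_Suc_atMost
      by (subst sum.swap) (simp add: mult.assoc)
    finally show ?thesis using c by simp
  qed
  have qn: "(fock_norm \<alpha> q)\<^sup>2 = (\<Sum>k<Suc n. (cmod (c k))\<^sup>2 * w k)"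
  proof -
    let ?u = "\<lambda>k. (cmod (if k < Suc n then c k else 0))\<^sup>2 * w k"
    have "?u sums (\<Sum>k<Suc n. ?u k)"
      by (rule sums_finite) auto
    also have "(\<Sum>k<Suc n. ?u k) = (\<Sum>k<Suc n. (cmod (c k))\<^sup>2 * w k)"
      by (rule sum.cong) auto
    finally show ?thesis
      using fock_norm_series[OF \<alpha> qc qF] sums_unique2 by blast
  qed
  have Tqn: "(fock_norm \<alpha> (T q))\<^sup>2 = (\<Sum>k<Suc n. (m k)\<^sup>2 * ((cmod (c k))\<^sup>2 * w k))"
  proof -
    let ?u = "\<lambda>k. (cmod (of_real (m k) * (if k < Suc n then c k else 0)))\<^sup>2 * w k"
    have "?u sums (\<Sum>k<Suc n. ?u k)"
      by (rule sums_finite) auto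
    also have "(\<Sum>k<Suc n. ?u k) = (\<Sum>k<Suc n. (m k)\<^sup>2 * ((cmod (c k))\<^sup>2 * w k))"
      by (rule sum.cong) (auto simp: norm_mult power_mult_distrib)
    finally show ?thesis
      using fock_norm_series[OF \<alpha> T_coeffs[OF qc] T_in_fock_space[OF qF]] sums_unique2 by blast
  qed
  have "(\<Sum>k<Suc n. (cmod (c k))\<^sup>2 * w k) > 0"
  proof -
    obtain i where i: "i < Suc n" "c i \<noteq> 0" using c0 by (auto simp: less_Suc_eq_le)
    then show ?thesis
      using fock_weight_pos[OF \<alpha>] fock_weight_nonneg[OF \<alpha>] by (intro sum_pos2[of _ i]) auto
  qed
  then have qpos: "fock_norm \<alpha> q > 0"
    using qn fock_norm_nonneg[of \<alpha> q] by (metis less_eq_real_def less_irrefl zero_power2)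
  \<comment> \<open>Only indices up to n occur in q, and there \<open>m n \<le> m k\<close>.\<close>
  have "(m n * fock_norm \<alpha> q)\<^sup>2 \<le> (fock_norm \<alpha> (T q))\<^sup>2"
    unfolding power_mult_distrib qn Tqn sum_distrib_left
    using m_le m_nonneg fock_weight_nonneg[OF \<alpha>] by (intro sum_mono mult_right_mono power_mono) auto
  then have Tq: "m n * fock_norm \<alpha> q \<le> fock_norm \<alpha> (T q)"
    using fock_norm_nonneg power2_le_imp_le by blast
  define s where "s = 1 / fock_norm \<alpha> q"
  define h where "h = (\<lambda>z. of_real s * q z)"
  have s: "s \<ge> 0" using qpos by (simp add: s_def)
  have hF: "h \<in> fock_space \<alpha>"
    using polynomial_in_fock_space[OF \<alpha>, of "\<lambda>i. of_real s * c i" "Suc n"]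
    by (simp add: h_def q_def sum_distrib_left mult.assoc del: sum.lessThan_Suc)
  have "fock_norm \<alpha> h = 1"
    using fock_norm_scale[OF \<alpha> s qF] qpos by (simp add: h_def s_def)
  \<comment> \<open>R kills h along with q, so only the scaled T q is left of the
    difference.\<close>
  moreover have "fock_norm \<alpha> (\<lambda>z. T h z - R h z) \<ge> m n"
  proof -
    have "T h = (\<lambda>z. of_real s * T q z)" "R h = (\<lambda>z. of_real s * R q z)"
      unfolding h_def by (rule linear_op_cmult[OF T_linear qF], rule linear_op_cmult[OF R qF])
    then have "fock_norm \<alpha> (\<lambda>z. T h z - R h z) = s * fock_norm \<alpha> (T q)"
      using fock_norm_scale[OF \<alpha> s T_in_fock_space[OF qF]] by (simp add: Rq)
    also have "\<dots> \<ge> m n"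
      using Tq qpos by (simp add: s_def field_simps)
    finally show ?thesis .
  qed
  ultimately show "ennreal (m n) \<le> fock_op_norm \<alpha> (\<lambda>f z. T f z - R f z)"
    unfolding fock_op_norm_def using hF by (intro SUP_upper2[of h] ennreal_leI) auto
qed

lemma sing_val_eq: "fock_sing_val \<alpha> T n = ennreal (m n)"
  using sing_val_le sing_val_ge by (rule antisym)

section \<open>Compactness and the Schatten criterion\<close>

text \<open>The head of T f depends on n coefficients, which range over compact discs and can be
  rounded to finite nets; the tail is small because \<open>m n < e / 2\<close>.\<close>

lemma compact:
  assumes "m \<longlonglongrightarrow> 0"
  shows "fock_compact_op \<alpha> T"
  unfolding fock_compact_op_def
proof (intro conjI T_linear allI impI)
  fix e :: real assume e: "e > 0"
  obtain n where n: "m n < e / 2"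
    using order_tendstoD(2)[OF assms, of "e / 2"] e by (auto simp: eventually_sequentially)
  \<comment> \<open>The added 1 keeps \<open>K\<close> positive even for an empty sum. Rounding each
    of the first n coefficients by less than \<open>\<delta>\<close> costs at most
    \<open>\<delta>\<^sup>2 * K = e\<^sup>2 / 4\<close> in the squared norm.\<close>
  define K where "K = (\<Sum>k<n. (m k)\<^sup>2 * w k) + 1"
  have K: "K > 0"
    unfolding K_def using fock_weight_nonneg[OF \<alpha>] by (intro add_nonneg_pos sum_nonneg) auto
  define \<delta> where "\<delta> = e / (2 * sqrt K)"
  have \<delta>: "\<delta> > 0" using e K by (simp add: \<delta>_def)
  have "\<exists>N. finite N \<and> cball (0::complex) (1 / sqrt (w k)) \<subseteq> (\<Union>x\<in>N. ball x \<delta>)" for k :: nat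
    using compact_eq_totally_bounded[of "cball (0::complex) (1 / sqrt (w k))"] \<delta> by auto
  then obtain N where N: "\<And>k::nat. finite (N k :: complex set)"
      "\<And>k. cball 0 (1 / sqrt (w k)) \<subseteq> (\<Union>x\<in>N k. ball x \<delta>)"
    by metis
  let ?p = "\<lambda>c z. \<Sum>k<n. (of_real (m k) * c k) * z ^ k"
  let ?G = "?p ` (PiE {..<n} N)"
  show "\<exists>G. finite G \<and> G \<subseteq> fock_space \<alpha> \<and>
      (\<forall>f\<in>fock_space \<alpha>. fock_norm \<alpha> f \<le> 1 \<longrightarrow> (\<exists>g\<in>G. fock_norm \<alpha> (\<lambda>z. T f z - g z) < e))"
  proof (intro exI[of _ ?G] conjI ballI impI)
    show "finite ?G"
      using N by (intro finite_imageI finite_PiE) auto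
    show "?G \<subseteq> fock_space \<alpha>"
      by (intro image_subsetI polynomial_in_fock_space[OF \<alpha>])
    fix f assume f: "f \<in> fock_space \<alpha>" "fock_norm \<alpha> f \<le> 1"
    let ?a = "taylor_coeff f"
    note a = entire_coeffs_taylor_coeff[OF f(1)]
    \<comment> \<open>One term of the Parseval sum is at most the squared norm of f, hence at most
      1.\<close>
    have "?a k \<in> cball 0 (1 / sqrt (w k))" for k
    proof -
      have "(cmod (?a k))\<^sup>2 * w k \<le> (fock_norm \<alpha> f)\<^sup>2"
        using sum_le_suminf[of "\<lambda>k. (cmod (?a k))\<^sup>2 * w k" "{k}"] fock_norm_series[OF \<alpha> a f(1)]
          fock_weight_nonneg[OF \<alpha>] by (auto simp: sums_iff)
      also have "\<dots> \<le> 1"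
        using f(2) fock_norm_nonneg by (simp add: power_le_one)
      finally have "(cmod (?a k))\<^sup>2 \<le> (1 / sqrt (w k))\<^sup>2"
        using fock_weight_pos[OF \<alpha>, of k] by (simp add: power_divide field_simps)
      moreover have "0 \<le> 1 / sqrt (w k)"
        by (simp add: fock_weight_nonneg[OF \<alpha>])
      ultimately have "cmod (?a k) \<le> 1 / sqrt (w k)"
        by (rule power2_le_imp_le)
      then show ?thesis by simp
    qed
    then have "?a k \<in> (\<Union>x\<in>N k. ball x \<delta>)" for k
      using subsetD[OF N(2)] by blast
    then have "\<forall>k. \<exists>x. x \<in> N k \<and> dist x (?a k) < \<delta>"
      by (simp add: Bex_def)
    from choice[OF this]
    obtain x where x: "\<And>k. x k \<in> N k" "\<And>k. dist (x k) (?a k) < \<delta>"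
      by blast
    \<comment> \<open>Restriction matches \<open>PiE\<close>, whose members are
      \<open>undefined\<close> from index n on; this is what makes the net finite.\<close>
    define c where "c = restrict x {..<n}"
    have cP: "c \<in> PiE {..<n} N" using x by (auto simp: c_def)
    let ?d = "\<lambda>k. if k < n then of_real (m k) * (?a k - c k) else of_real (m k) * ?a k"
    let ?D = "\<lambda>z. T f z - ?p c z"
    have D: "entire_coeffs ?d ?D"
    proof -
      have "entire_coeffs (\<lambda>k. of_real (m k) * ?a k - (if k < n then of_real (m k) * c k else 0)) ?D"
        by (intro entire_coeffs_diff T_coeffs entire_coeffs_polynomial a)
      then show ?thesis
        by (rule back_subst[of "\<lambda>c. entire_coeffs c _"]) (auto simp: algebra_simps)
    qed
    \<comment> \<open>Majorant for the error: the rounding cost on the head plus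
      \<open>(m n)\<^sup>2\<close> times the full Parseval series of f, which overcounts the head
      but has a known sum.\<close>
    let ?h = "\<lambda>k. (if k \<in> {..<n} then (m k)\<^sup>2 * \<delta>\<^sup>2 * w k else 0) + (m n)\<^sup>2 * ((cmod (?a k))\<^sup>2 * w k)"
    have hs: "?h sums ((\<Sum>k<n. (m k)\<^sup>2 * \<delta>\<^sup>2 * w k) + (m n)\<^sup>2 * (fock_norm \<alpha> f)\<^sup>2)"
      by (intro sums_add sums_mult fock_norm_series[OF \<alpha> a f(1)] sums_If_finite_set) simp
    have le: "(cmod (?d k))\<^sup>2 * w k \<le> ?h k" for k
    proof (cases "k < n")
      case True
      have "(cmod (?a k - c k))\<^sup>2 \<le> \<delta>\<^sup>2"
        using x(2)[of k] True by (intro power_mono) (auto simp: c_def dist_norm norm_minus_commute)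
      then have "(m k)\<^sup>2 * (cmod (?a k - c k))\<^sup>2 * w k \<le> (m k)\<^sup>2 * \<delta>\<^sup>2 * w k"
        using fock_weight_nonneg[OF \<alpha>] by (intro mult_right_mono mult_left_mono) auto
      moreover have "0 \<le> (m n)\<^sup>2 * ((cmod (?a k))\<^sup>2 * w k)"
        using fock_weight_nonneg[OF \<alpha>] by simp
      ultimately show ?thesis
        using True by (simp add: norm_mult power_mult_distrib)
    next
      case False
      then have "(m k)\<^sup>2 \<le> (m n)\<^sup>2"
        using m_le[of n k] m_nonneg by (intro power_mono) auto
      then show ?thesis
        using False fock_weight_nonneg[OF \<alpha>]
        by (simp add: norm_mult power_mult_distrib mult.assoc mult_right_mono)
    qed
    have sd: "summable (\<lambda>k. (cmod (?d k))\<^sup>2 * w k)"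
    proof (rule summable_comparison_test')
      show "summable ?h" using hs sums_summable by blast
      show "norm ((cmod (?d k))\<^sup>2 * w k) \<le> ?h k" if "k \<ge> 0" for k
        using le[of k] fock_weight_nonneg[OF \<alpha>, of k] by simp
    qed
    \<comment> \<open>Head and tail each contribute at most a quarter of the square of e.\<close>
    define C where "C = sqrt (e\<^sup>2 / 2)"
    have "(\<Sum>k. (cmod (?d k))\<^sup>2 * w k) \<le> (\<Sum>k<n. (m k)\<^sup>2 * \<delta>\<^sup>2 * w k) + (m n)\<^sup>2 * (fock_norm \<alpha> f)\<^sup>2"
      unfolding sums_unique[OF hs] by (rule suminf_le[OF le sd sums_summable[OF hs]])
    also have "(\<Sum>k<n. (m k)\<^sup>2 * \<delta>\<^sup>2 * w k) = \<delta>\<^sup>2 * (K - 1)"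
      by (simp add: K_def sum_distrib_left mult_ac)
    also have "\<delta>\<^sup>2 * (K - 1) \<le> \<delta>\<^sup>2 * K"
      by (intro mult_left_mono) auto
    also have "\<delta>\<^sup>2 * K = e\<^sup>2 / 4"
      using K by (simp add: \<delta>_def power_divide power_mult_distrib)
    also have "(m n)\<^sup>2 * (fock_norm \<alpha> f)\<^sup>2 \<le> (e / 2)\<^sup>2 * 1\<^sup>2"
      using n m_nonneg f(2) fock_norm_nonneg by (intro mult_mono power_mono) auto
    finally have "(\<Sum>k. (cmod (?d k))\<^sup>2 * w k) \<le> C\<^sup>2"
      by (simp add: C_def power_divide)
    then have "fock_norm \<alpha> ?D \<le> C"
      by (intro fock_normI(2)[OF \<alpha> D sd]) (auto simp: C_def)
    also have "C < e"
      unfolding C_def using e by (intro real_less_lsqrt) (auto simp: power2_eq_square)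
    finally show "\<exists>g\<in>?G. fock_norm \<alpha> (\<lambda>z. T f z - g z) < e"
      by (intro bexI[where x = "?p c"] imageI cP)
  qed
qed

text \<open>With the singular values equal to \<open>m n\<close>, the converse lacks only
  compactness; summability forces \<open>m n powr p\<close>, and hence \<open>m n\<close>, to tend
  to zero.\<close>

theorem schatten_class_iff:
  assumes p: "p > 0"
  shows "schatten_class \<alpha> p T \<longleftrightarrow> summable (\<lambda>n. m n powr p)"
proof
  assume "schatten_class \<alpha> p T"
  then show "summable (\<lambda>n. m n powr p)"
    by (simp add: schatten_class_def sing_val_eq m_nonneg)
next
  assume s: "summable (\<lambda>n. m n powr p)"
  have "(\<lambda>n. (m n powr p) powr (1 / p)) \<longlonglongrightarrow> 0 powr (1 / p)"
    using summable_LIMSEQ_zero[OF s] p by (intro tendsto_powr') auto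
  then have "m \<longlonglongrightarrow> 0"
    using p m_nonneg by (simp add: powr_powr)
  then show "schatten_class \<alpha> p T"
    using s compact by (simp add: schatten_class_def sing_val_eq m_nonneg)
qed

end

subsection \<open>The Hausdorff operator\<close>

context
  fixes \<mu> :: "real measure"
  assumes sets_mu: "sets \<mu> = sets (restrict_space borel {0<..})"
    and null: "emeasure \<mu> {0<..<1} = 0"
    and fin: "(SUP n::nat. \<integral>\<^sup>+ t. ennreal (indicator {1..} t / t ^ (n + 1)) \<partial>\<mu>) < \<infinity>"
begin

text \<open>The sets of \<mu> are the traces of Borel sets on the positive half-line, to which Borel
  functions restrict.\<close>

lemma borel_measurable_mu:
  "f \<in> borel_measurable borel \<Longrightarrow> f \<in> borel_measurable \<mu>"
  using measurable_restrict_space1[of f borel borel "{0<..}"] measurable_cong_sets[OF sets_mu refl] by blast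

text \<open>The space of \<mu> is the positive half-line and its part below 1 is null. The later
  bounds on powers of 1 / t rest on this.\<close>

lemma AE_mu_ge_1: "AE t in \<mu>. t \<ge> 1"
proof -
  have sp: "space \<mu> = {0<..}"
    using sets_eq_imp_space_eq[OF sets_mu] by (simp add: space_restrict_space)
  have "{0<..<1::real} \<in> sets \<mu>"
    unfolding sets_mu by (auto simp: sets_restrict_space)
  then have "{0<..<1} \<in> null_sets \<mu>"
    using null by (simp add: null_setsI)
  then have "AE t in \<mu>. t \<notin> {0<..<1}"
    by (rule AE_not_in)
  then show ?thesis
    using AE_space by eventually_elim (auto simp: sp)
qed

text \<open>Taken over the whole space, which agrees with \<open>{1..}\<close> up to a null set; by
  \<open>integrable_moment\<close> it is never the default value of a divergent integral.\<close>

definition moment :: "nat \<Rightarrow> real" where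
  "moment n = (\<integral>t. 1 / t ^ (n + 1) \<partial>\<mu>)"

lemma set_integral_eq_moment: "(\<integral>t\<in>{1..}. 1 / t ^ (n + 1) \<partial>\<mu>) = moment n"
  unfolding moment_def set_lebesgue_integral_def
  by (intro integral_cong_AE borel_measurable_mu eventually_mono[OF AE_mu_ge_1]) auto

lemma integrable_moment: "integrable \<mu> (\<lambda>t. 1 / t ^ (n + 1))"
proof (rule integrableI_bounded)
  show "(\<lambda>t. 1 / t ^ (n + 1)) \<in> borel_measurable \<mu>"
    by (intro borel_measurable_mu) measurable
  have "(\<integral>\<^sup>+ t. ennreal (norm (1 / t ^ (n + 1))) \<partial>\<mu>)
      = (\<integral>\<^sup>+ t. ennreal (indicator {1..} t / t ^ (n + 1)) \<partial>\<mu>)"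
    by (intro nn_integral_cong_AE eventually_mono[OF AE_mu_ge_1]) (auto simp: abs_of_nonneg)
  also have "\<dots> \<le> (SUP n::nat. \<integral>\<^sup>+ t. ennreal (indicator {1..} t / t ^ (n + 1)) \<partial>\<mu>)"
    by (rule SUP_upper) simp
  finally show "(\<integral>\<^sup>+ t. ennreal (norm (1 / t ^ (n + 1))) \<partial>\<mu>) < \<infinity>"
    using fin by (rule le_less_trans)
qed

lemma moment_nonneg: "moment n \<ge> 0"
  unfolding moment_def by (intro integral_nonneg_AE eventually_mono[OF AE_mu_ge_1]) auto

text \<open>For t at least 1 the integrand decreases pointwise in n.\<close>

lemma decseq_moment: "decseq moment"
  unfolding decseq_def moment_def
proof (intro allI impI integral_mono_AE integrable_moment eventually_mono[OF AE_mu_ge_1])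
  fix k n :: nat and t :: real
  assume "k \<le> n" "1 \<le> t"
  then show "1 / t ^ (n + 1) \<le> 1 / t ^ (k + 1)"
    by (intro divide_left_mono power_increasing) auto
qed

text \<open>Inserting z / t into the power series gives a series in powers of 1 / t, whose integrals
  are the moments. Sum and integral may be exchanged because the integrated norms are dominated by
  \<open>moment 0\<close> times the \<open>cmod (a k * z ^ k)\<close>.\<close>

lemma hausdorff_op_coeffs:
  assumes "entire_coeffs a f"
  shows "entire_coeffs (\<lambda>k. of_real (moment k) * a k) (hausdorff_op \<mu> f)"
  unfolding entire_coeffs_def
proof
  fix z
  let ?g = "\<lambda>k t. a k * z ^ k * of_real (1 / t ^ (k + 1))"
  have f: "\<And>z. (\<lambda>k. a k * z ^ k) sums f z"
    using assms by (simp add: entire_coeffs_def)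
  have sn: "summable (\<lambda>k. cmod (a k * z ^ k))"
    by (rule summable_norm_entire_series[OF f])
  have int: "integrable \<mu> (?g k)" for k
    by (intro integrable_mult_right integrable_of_real integrable_moment)
  have intg: "(\<integral>t. ?g k t \<partial>\<mu>) = of_real (moment k) * a k * z ^ k" for k
    using integrable_moment[of k] by (simp add: moment_def mult_ac del: of_real_divide of_real_power)
  have nrm: "(\<integral>t. norm (?g k t) \<partial>\<mu>) = cmod (a k * z ^ k) * moment k" for k
  proof -
    have "(\<integral>t. norm (?g k t) \<partial>\<mu>) = (\<integral>t. cmod (a k * z ^ k) * (1 / t ^ (k + 1)) \<partial>\<mu>)"
      by (intro integral_cong_AE borel_measurable_mu eventually_mono[OF AE_mu_ge_1])
         (auto simp: norm_mult norm_divide norm_power)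
    then show ?thesis
      unfolding moment_def by (simp only: integral_mult_right_zero)
  qed
  have AEs: "AE t in \<mu>. summable (\<lambda>k. norm (?g k t))"
  proof (rule eventually_mono[OF AE_mu_ge_1])
    fix t :: real assume "1 \<le> t"
    then have t: "norm (of_real (1 / t ^ (k + 1)) :: complex) \<le> 1" for k
      using one_le_power[of t "Suc k"] by (simp only: norm_of_real) (simp add: abs_of_nonneg)
    show "summable (\<lambda>k. norm (?g k t))"
    proof (rule summable_comparison_test'[OF sn, of 0])
      fix k
      have "norm (?g k t) \<le> cmod (a k * z ^ k)"
        unfolding norm_mult[of "a k * z ^ k"] by (rule mult_left_le[OF t norm_ge_zero])
      then show "norm (norm (?g k t)) \<le> cmod (a k * z ^ k)"
        by (simp only: real_norm_def abs_norm_cancel)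
    qed
  qed
  have sI: "summable (\<lambda>k. \<integral>t. norm (?g k t) \<partial>\<mu>)"
    unfolding nrm
  proof (rule summable_comparison_test'[OF summable_mult2[OF sn, of "moment 0"], of 0])
    fix k show "norm (cmod (a k * z ^ k) * moment k) \<le> cmod (a k * z ^ k) * moment 0"
      using moment_nonneg[of k] decseqD[OF decseq_moment, of 0 k] by (simp add: abs_mult mult_left_mono)
  qed
  have "(\<lambda>k. \<integral>t. ?g k t \<partial>\<mu>) sums (\<integral>t. (\<Sum>k. ?g k t) \<partial>\<mu>)"
    using int AEs sI by (rule sums_integral)
  also have "(\<integral>t. (\<Sum>k. ?g k t) \<partial>\<mu>) = hausdorff_op \<mu> f z"
    unfolding hausdorff_op_def
  proof (rule integral_cong_AE)
    \<comment> \<open>Valid for every real t: at t = 0 both sides vanish since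
      \<open>1 / 0 = 0\<close>. Measurability of the Hausdorff integrand is therefore inherited from
      the series.\<close>
    have eq: "(\<Sum>k. ?g k t) = 1 / of_real t * f (z / of_real t)" for t
    proof -
      have "(\<lambda>k. 1 / of_real t * (a k * (z / of_real t) ^ k)) sums (1 / of_real t * f (z / of_real t))"
        by (intro sums_mult f)
      then show ?thesis
        by (subst sums_unique) (simp_all add: power_divide mult_ac)
    qed
    then show "AE t in \<mu>. (\<Sum>k. ?g k t) = 1 / of_real t * f (z / of_real t)" by simp
    show m: "(\<lambda>t. \<Sum>k. ?g k t) \<in> borel_measurable \<mu>"
      by (intro borel_measurable_mu) measurable
    then show "(\<lambda>t. 1 / of_real t * f (z / of_real t)) \<in> borel_measurable \<mu>"
      unfolding eq .
  qed
  finally show "(\<lambda>k. of_real (moment k) * a k * z ^ k) sums hausdorff_op \<mu> f z"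
    unfolding intg .
qed

end

theorem theorem4:
  fixes \<alpha> p :: real and \<mu> :: "real measure"
  assumes "\<alpha> > 0"
    and "sets \<mu> = sets (restrict_space borel {0<..})"
    and "emeasure \<mu> {0<..<1} = 0"
    and "(SUP n::nat. \<integral>\<^sup>+ t. ennreal (indicator {1..} t / t ^ (n + 1)) \<partial>\<mu>) < \<infinity>"
    and "p > 0"
  shows "schatten_class \<alpha> p (hausdorff_op \<mu>) \<longleftrightarrow>
         summable (\<lambda>n::nat. (\<integral>t\<in>{1..}. 1 / t ^ (n + 1) \<partial>\<mu>) powr p)"
proof -
  \<comment> \<open>The diagonal setting applies with the moments as multipliers; rewriting them as
    integrals over \<open>{1..}\<close> gives the stated series.\<close>
  interpret fock_diagonal \<alpha> "moment \<mu>" "hausdorff_op \<mu>"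
    using assms(1) moment_nonneg[OF assms(2-4)] decseq_moment[OF assms(2-4)] hausdorff_op_coeffs[OF assms(2-4)]
    by unfold_locales auto
  show ?thesis
    unfolding set_integral_eq_moment[OF assms(2-4)] by (rule schatten_class_iff[OF assms(5)])
qed

end
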